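(* Let $\lambda\in\mathbb{K}$, let $(A,\mu,R,d)$ be a modified Rota-Baxter LieDer pair of weight $\lambda$, and let $(\mu_t,R_t,d_t)$ and $(\mu_t',R_t',d_t')$ be two equivalent one-parameter formal deformations of it. Then their infinitesimals $(\mu_1,R_1,d_1)$ and $(\mu_1',R_1',d_1')$ are in the same cohomology class in $\mathcal{H}^2_{\mathrm{mRBLD}^\lambda}(A,A)$.
   Context: $\mathbb{K}$ is a field of characteristic $0$. A modified Rota-Baxter LieDer pair of weight $\lambda$ is $(A,\mu,R,d)$ where $(A,\mu)$ is a Lie algebra with bracket $\mu=[-,-]$, $R:A\to A$ is linear with $[Ra,Rb]=R([Ra,b]+[a,Rb])+\lambda[a,b]$ for all $a,b\in A$, and $d$ is a derivation of $(A,\mu)$ with $R\circ d=d\circ R$. (The same definition is used over $\mathbb{K}[\![t]\!]$.) A one-parameter formal deformation of $(A,\mu,R,d)$ is a triple of power series $\mu_t=\sum_{i\ge0}\mu_it^i$ with $\mu_i\in\mathrm{Hom}(\wedge^2A,A)$, $R_t=\sum_{i\ge0}R_it^i$ and $d_t=\sum_{i\ge0}d_it^i$ with $R_i,d_i\in\mathrm{Hom}(A,A)$, such that $(\mu_0,R_0,d_0)=(\mu,R,d)$ and $(A[\![t]\!],\mu_t,R_t,d_t)$ (with the maps extended $\mathbb{K}[\![t]\!]$-linearly) is a modified Rota-Baxter LieDer pair of weight $\lambda$ over $\mathbb{K}[\![t]\!]$. Its infinitesimal is $(\mu_1,R_1,d_1)$. Two such deformations $(\mu_t,R_t,d_t)$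 and $(\mu_t',R_t',d_t')$ are equivalent if there is a formal isomorphism between them: a power series $\psi_t=\sum_{i\ge0}\psi_it^i:A[\![t]\!]\to A[\![t]\!]$ with $\psi_i:A\to A$ linear, $\psi_0=\mathrm{Id}_A$, $\psi_t\circ\mu_t'=\mu_t\circ(\psi_t\otimes\psi_t)$, $\psi_t\circ R_t'=R_t\circ\psi_t$, $\psi_t\circ d_t'=d_t\circ\psi_t$. Low-degree part of the complex with coefficients in the adjoint representation: let $[a,b]_R=[Ra,b]+[a,Rb]$ and $\rho_R(a)b=[Ra,b]-R[a,b]$. Then $\mathfrak{C}^1_{\mathrm{mRBLD}^\lambda}(A,A)=\mathrm{Hom}(A,A)$, $\mathfrak{C}^2_{\mathrm{mRBLD}^\lambda}(A,A)=\big(\mathrm{Hom}(\wedge^2A,A)\oplus\mathrm{Hom}(A,A)\big)\times\big(\mathrm{Hom}(A,A)\oplus A\big)$, and a triple $(f,g,h)$ with $f\in\mathrm{Hom}(\wedge^2A,A)$, $g,h\in\mathrm{Hom}(A,A)$ is regarded as $((f,g),(h,0))$. The differentials are $$\mathfrak{D}^1_{\mathrm{mRBLD}^\lambda}(\psi)=\big((\delta^1_{\mathrm{CE}}\psi,-\phi^1\psi),(-\Delta^1\psi,0)\big),$$ $$\mathfrak{D}^2_{\mathrm{mRBLD}^\lambda}((f,g),(h,s))=\Big(\big(\delta^2_{\mathrm{CE}}f,\,-\delta^1_{\mathrm{mRBO}^\lambda}g-\phi^2f\big),\ \big(\delta^1_{\mathrm{CE}}h+\Delta^2f,\,-\delta^0_{\mathrm{mRBO}^\lambda}s-\phi^1h+\Delta^1g\big)\Big),$$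 where $\delta^2_{\mathrm{CE}}f(a,b,c)=-[a,f(b,c)]+[b,f(a,c)]-[c,f(a,b)]+f([a,b],c)-f([a,c],b)+f([b,c],a)$; $\delta^1_{\mathrm{CE}}h(a,b)=[a,h(b)]-[b,h(a)]-h([a,b])$; $\delta^1_{\mathrm{mRBO}^\lambda}g(a,b)=\rho_R(a)g(b)-\rho_R(b)g(a)-g([a,b]_R)$; $\delta^0_{\mathrm{mRBO}^\lambda}s(a)=-\rho_R(a)s$; $\phi^1h(a)=h(Ra)-R(h(a))$; $\phi^2f(a,b)=f(Ra,Rb)-R(f(Ra,b))-R(f(a,Rb))-\lambda f(a,b)$; $\Delta^1g(a)=g(da)-d(g(a))$; $\Delta^2f(a,b)=f(da,b)+f(a,db)-d(f(a,b))$. $\mathcal{H}^2_{\mathrm{mRBLD}^\lambda}(A,A)=\ker\mathfrak{D}^2_{\mathrm{mRBLD}^\lambda}/\operatorname{im}\mathfrak{D}^1_{\mathrm{mRBLD}^\lambda}$. Infinitesimals of deformations are $2$-cocycles. *)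

theory Defs
  imports
    "HOL-Computational_Algebra.Formal_Power_Series"
    "HOL-Library.Function_Algebras"
    "HOL-Library.Product_Plus"
begin

section \<open>Modified Rota-Baxter LieDer pairs\<close>

text \<open>
  The scalars form a commutative ring, so that one definition serves both over a field
  and over its ring of formal power series. For scalars in a field the locale
  \<^locale>\<open>module\<close> has the same axioms as \<^locale>\<open>vector_space\<close>.
\<close>

text \<open>\<open>Hom(\<Lambda>\<^sup>2 A, A)\<close> is represented by the alternating bilinear maps on \<open>A\<close>.\<close>

definition alternating_bilinear ::
    "('r::comm_ring_1 \<Rightarrow> 'a::ab_group_add \<Rightarrow> 'a) \<Rightarrow> ('a \<Rightarrow> 'a \<Rightarrow> 'a) \<Rightarrow> bool" where
  "alternating_bilinear scale f \<longleftrightarrow>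
     (\<forall>a. module_hom scale scale (\<lambda>b. f a b)) \<and>
     (\<forall>b. module_hom scale scale (\<lambda>a. f a b)) \<and>
     (\<forall>a. f a a = 0)"

locale lie_algebra = module scale
  for scale :: "'r::comm_ring_1 \<Rightarrow> 'a::ab_group_add \<Rightarrow> 'a" (infixr \<open>*s\<close> 75) +
  fixes \<mu> :: "'a \<Rightarrow> 'a \<Rightarrow> 'a"
  assumes bracket_alternating_bilinear: "alternating_bilinear scale \<mu>"
    and jacobi: "\<mu> a (\<mu> b c) + \<mu> b (\<mu> c a) + \<mu> c (\<mu> a b) = 0"

locale modified_RB_LieDer_pair = lie_algebra scale \<mu>
  for scale :: "'r::comm_ring_1 \<Rightarrow> 'a::ab_group_add \<Rightarrow> 'a" (infixr \<open>*s\<close> 75)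
    and \<mu> :: "'a \<Rightarrow> 'a \<Rightarrow> 'a" +
  fixes lam :: 'r and R :: "'a \<Rightarrow> 'a" and d :: "'a \<Rightarrow> 'a"
  assumes R_linear: "module_hom scale scale R"
    and R_modified_Rota_Baxter:
      "\<mu> (R a) (R b) = R (\<mu> (R a) b + \<mu> a (R b)) + lam *s \<mu> a b"
    and d_linear: "module_hom scale scale d"
    and d_derivation: "d (\<mu> a b) = \<mu> (d a) b + \<mu> a (d b)"
    and R_d_commute: "R \<circ> d = d \<circ> R"


section \<open>Low-degree cochain complex with coefficients in the adjoint representation\<close>

text \<open>Addition, subtraction and zero of cochains are pointwise and componentwise.\<close>

type_synonym 'a cochain2 = "(('a \<Rightarrow> 'a \<Rightarrow> 'a) \<times> ('a \<Rightarrow> 'a)) \<times> (('a \<Rightarrow> 'a) \<times> 'a)"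

type_synonym 'a cochain3 =
  "(('a \<Rightarrow> 'a \<Rightarrow> 'a \<Rightarrow> 'a) \<times> ('a \<Rightarrow> 'a \<Rightarrow> 'a)) \<times> (('a \<Rightarrow> 'a \<Rightarrow> 'a) \<times> ('a \<Rightarrow> 'a))"

context modified_RB_LieDer_pair
begin

definition bracket_R :: "'a \<Rightarrow> 'a \<Rightarrow> 'a" where
  "bracket_R a b = \<mu> (R a) b + \<mu> a (R b)"

definition rho_R :: "'a \<Rightarrow> 'a \<Rightarrow> 'a" where
  "rho_R a b = \<mu> (R a) b - R (\<mu> a b)"

definition delta1_CE :: "('a \<Rightarrow> 'a) \<Rightarrow> 'a \<Rightarrow> 'a \<Rightarrow> 'a" where
  "delta1_CE h a b = \<mu> a (h b) - \<mu> b (h a) - h (\<mu> a b)"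

definition delta2_CE :: "('a \<Rightarrow> 'a \<Rightarrow> 'a) \<Rightarrow> 'a \<Rightarrow> 'a \<Rightarrow> 'a \<Rightarrow> 'a" where
  "delta2_CE f a b c =
     - \<mu> a (f b c) + \<mu> b (f a c) - \<mu> c (f a b)
     + f (\<mu> a b) c - f (\<mu> a c) b + f (\<mu> b c) a"

definition delta0_mRBO :: "'a \<Rightarrow> 'a \<Rightarrow> 'a" where
  "delta0_mRBO s a = - rho_R a s"

definition delta1_mRBO :: "('a \<Rightarrow> 'a) \<Rightarrow> 'a \<Rightarrow> 'a \<Rightarrow> 'a" where
  "delta1_mRBO g a b = rho_R a (g b) - rho_R b (g a) - g (bracket_R a b)"

definition phi1 :: "('a \<Rightarrow> 'a) \<Rightarrow> 'a \<Rightarrow> 'a" where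
  "phi1 h a = h (R a) - R (h a)"

definition phi2 :: "('a \<Rightarrow> 'a \<Rightarrow> 'a) \<Rightarrow> 'a \<Rightarrow> 'a \<Rightarrow> 'a" where
  "phi2 f a b = f (R a) (R b) - R (f (R a) b) - R (f a (R b)) - lam *s f a b"

definition Delta1 :: "('a \<Rightarrow> 'a) \<Rightarrow> 'a \<Rightarrow> 'a" where
  "Delta1 g a = g (d a) - d (g a)"

definition Delta2 :: "('a \<Rightarrow> 'a \<Rightarrow> 'a) \<Rightarrow> 'a \<Rightarrow> 'a \<Rightarrow> 'a" where
  "Delta2 f a b = f (d a) b + f a (d b) - d (f a b)"

definition C1 :: "('a \<Rightarrow> 'a) set" where
  "C1 = {\<psi>. module_hom scale scale \<psi>}"

definition C2 :: "'a cochain2 set" where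
  "C2 = {((f, g), (h, s)) | f g h s.
     alternating_bilinear scale f \<and> module_hom scale scale g \<and> module_hom scale scale h}"

definition D1 :: "('a \<Rightarrow> 'a) \<Rightarrow> 'a cochain2" where
  "D1 \<psi> = ((delta1_CE \<psi>, - phi1 \<psi>), (- Delta1 \<psi>, 0))"

definition D2 :: "'a cochain2 \<Rightarrow> 'a cochain3" where
  "D2 = (\<lambda>((f, g), (h, s)).
     ((delta2_CE f, - delta1_mRBO g - phi2 f),
      (delta1_CE h + Delta2 f, - delta0_mRBO s - phi1 h + Delta1 g)))"

definition Z2 :: "'a cochain2 set" where
  "Z2 = {x \<in> C2. D2 x = 0}"

definition B2 :: "'a cochain2 set" where
  "B2 = D1 ` C1"

definition cohomologous :: "('a cochain2 \<times> 'a cochain2) set" where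
  "cohomologous = {(x, y). x \<in> Z2 \<and> y \<in> Z2 \<and> x - y \<in> B2}"

definition H2 :: "'a cochain2 set set" where
  "H2 = Z2 // cohomologous"

lemma cohomologous_equiv: "equiv Z2 cohomologous"
proof -
  have lin: "module_hom scale scale (\<lambda>x. 0)"
    by unfold_locales simp_all
  have mu: "\<mu> a 0 = 0" "\<mu> a (- b) = - \<mu> a b" "\<mu> a (b + c) = \<mu> a b + \<mu> a c" for a b c
    using bracket_alternating_bilinear unfolding alternating_bilinear_def
    by (auto dest!: spec[of _ a] simp: module_hom.zero module_hom.neg module_hom.add)
  have R: "R 0 = 0" "R (- b) = - R b" "R (b + c) = R b + R c" for b c
    using R_linear by (auto simp: module_hom.zero module_hom.neg module_hom.add)
  have d: "d 0 = 0" "d (- b) = - d b" "d (b + c) = d b + d c" for b c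
    using d_linear by (auto simp: module_hom.zero module_hom.neg module_hom.add)
  note defs = D1_def delta1_CE_def phi1_def Delta1_def fun_eq_iff mu R d
    zero_prod_def uminus_prod_def plus_prod_def
  have zero: "0 \<in> B2"
    unfolding B2_def C1_def using lin
    by (auto simp: defs intro!: image_eqI[where x = "\<lambda>x. 0"])
  have minus: "- x \<in> B2" if "x \<in> B2" for x
  proof -
    from that obtain \<psi> where x: "x = D1 \<psi>" and \<psi>: "module_hom scale scale \<psi>"
      by (auto simp: B2_def C1_def)
    then have "- x = D1 (\<lambda>a. - \<psi> a)" by (auto simp: defs)
    moreover have "module_hom scale scale (\<lambda>a. - \<psi> a)"
    proof -
      interpret \<psi>: module_hom scale scale \<psi> by fact
      show ?thesis by unfold_locales (simp_all add: \<psi>.add \<psi>.scale)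
    qed
    ultimately show ?thesis by (auto simp: B2_def C1_def)
  qed
  have add: "x + y \<in> B2" if "x \<in> B2" "y \<in> B2" for x y
  proof -
    from that obtain \<psi> \<chi> where x: "x = D1 \<psi>" "y = D1 \<chi>"
      and \<psi>: "module_hom scale scale \<psi>" and \<chi>: "module_hom scale scale \<chi>"
      by (auto simp: B2_def C1_def)
    then have "x + y = D1 (\<lambda>a. \<psi> a + \<chi> a)" by (auto simp: defs algebra_simps)
    moreover have "module_hom scale scale (\<lambda>a. \<psi> a + \<chi> a)"
    proof -
      interpret \<psi>: module_hom scale scale \<psi> by fact
      interpret \<chi>: module_hom scale scale \<chi> by fact
      show ?thesis
        by unfold_locales (simp_all add: \<psi>.add \<psi>.scale \<chi>.add \<chi>.scale algebra_simps)
    qed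
    ultimately show ?thesis by (auto simp: B2_def C1_def)
  qed
  have symm: "y - x \<in> B2" if "x - y \<in> B2" for x y
    using minus[OF that] by simp
  have transi: "x - z \<in> B2" if "x - y \<in> B2" "y - z \<in> B2" for x y z
    using add[OF that] by simp
  show ?thesis
  proof (rule equivI)
    show "cohomologous \<subseteq> Z2 \<times> Z2"
      unfolding cohomologous_def by auto
    show "refl_on Z2 cohomologous"
      unfolding cohomologous_def refl_on_def using zero by simp
    show "sym cohomologous"
      unfolding cohomologous_def sym_def using symm by blast
    show "trans cohomologous"
      unfolding cohomologous_def trans_def using transi by blast
  qed
qed

lemma coboundaries_are_cocycles: "B2 \<subseteq> Z2"
proof
  fix x assume "x \<in> B2"
  then obtain \<psi> where x: "x = D1 \<psi>" and \<psi>: "module_hom scale scale \<psi>"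
    by (auto simp: B2_def C1_def)
  have mul: "module_hom scale scale (\<mu> a)" and mur: "module_hom scale scale (\<lambda>a. \<mu> a b)"
    and alt: "\<mu> a a = 0" for a b
    using bracket_alternating_bilinear unfolding alternating_bilinear_def by auto
  note ml [simp] = module_hom.add[OF mul] module_hom.neg[OF mul] module_hom.diff[OF mul]
    module_hom.scale[OF mul]
  note mr [simp] = module_hom.add[OF mur] module_hom.neg[OF mur] module_hom.diff[OF mur]
    module_hom.scale[OF mur]
  note Rl [simp] = module_hom.add[OF R_linear] module_hom.neg[OF R_linear]
    module_hom.diff[OF R_linear] module_hom.scale[OF R_linear]
  note dl [simp] = module_hom.add[OF d_linear] module_hom.neg[OF d_linear]
    module_hom.diff[OF d_linear] module_hom.scale[OF d_linear]
  note pl [simp] = module_hom.add[OF \<psi>] module_hom.neg[OF \<psi>] module_hom.diff[OF \<psi>]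
    module_hom.scale[OF \<psi>]
  have skew: "\<mu> a b = - \<mu> b a" for a b
  proof -
    have "\<mu> (a + b) (a + b) = \<mu> a b + \<mu> b a"
      unfolding ml mr by (simp add: alt)
    then show ?thesis by (simp add: alt eq_neg_iff_add_eq_0)
  qed
  have Rd: "R (d a) = d (R a)" for a
    using R_d_commute by (simp add: fun_eq_iff)
  have "alternating_bilinear scale (delta1_CE \<psi>)"
    unfolding alternating_bilinear_def
    by (auto simp: delta1_CE_def alt module_hom.zero[OF \<psi>] algebra_simps
        intro!: module_hom.intro module_axioms module_hom_axioms.intro)
  moreover have "module_hom scale scale (- phi1 \<psi>)" "module_hom scale scale (- Delta1 \<psi>)"
    by (auto simp: phi1_def Delta1_def algebra_simps intro!: module_hom.intro module_axioms
        module_hom_axioms.intro)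
  ultimately have C2: "x \<in> C2" by (auto simp: x D1_def C2_def)
  have "delta2_CE (delta1_CE \<psi>) a b c = 0" for a b c
  proof -
    have J: "\<mu> (\<mu> a b) c = \<mu> a (\<mu> b c) - \<mu> b (\<mu> a c)" for a b c
    proof -
      have "\<mu> b (\<mu> c a) = - \<mu> b (\<mu> a c)"
        using skew[of c a] by simp
      then have "\<mu> a (\<mu> b c) = \<mu> b (\<mu> a c) - \<mu> c (\<mu> a b)"
        using jacobi[of a b c] by (simp add: algebra_simps)
      then show ?thesis
        using skew[of "\<mu> a b" c] by simp
    qed
    have K: "\<mu> c (\<mu> a b) = \<mu> b (\<mu> a c) - \<mu> a (\<mu> b c)"
      using J[of a b c] skew[of c "\<mu> a b"] by simp
    show ?thesis
      by (simp add: delta2_CE_def delta1_CE_def J K skew[of c b] skew[of c a] skew[of b a])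
  qed
  moreover have "(- delta1_mRBO (- phi1 \<psi>) - phi2 (delta1_CE \<psi>)) a b = 0" for a b
  proof -
    have [simp]: "\<mu> (R a) (R b) = R (\<mu> (R a) b) + R (\<mu> a (R b)) + lam *s \<mu> a b" for a b
      by (simp add: R_modified_Rota_Baxter)
    show ?thesis
      by (simp add: delta1_mRBO_def phi1_def phi2_def delta1_CE_def bracket_R_def rho_R_def algebra_simps)
  qed
  moreover have "(delta1_CE (- Delta1 \<psi>) + Delta2 (delta1_CE \<psi>)) a b = 0" for a b
    by (simp add: delta1_CE_def Delta1_def Delta2_def d_derivation algebra_simps)
  moreover have "(- delta0_mRBO 0 - phi1 (- Delta1 \<psi>) + Delta1 (- phi1 \<psi>)) a = 0" for a
    using module_hom.zero[OF \<psi>] module_hom.zero[OF mul] module_hom.zero[OF R_linear]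
    by (simp add: delta0_mRBO_def rho_R_def phi1_def Delta1_def Rd algebra_simps)
  ultimately have "D2 x = 0"
    by (simp add: x D1_def D2_def zero_prod_def fun_eq_iff)
  with C2 show "x \<in> Z2" by (simp add: Z2_def)
qed

end


section \<open>Formal deformations\<close>

text \<open>
  \<open>A[[t]]\<close> is the type \<^typ>\<open>'a fps\<close>; this is its module structure over the ring
  \<open>K[[t]]\<close> of formal power series.
\<close>

definition fps_scale ::
    "('k::comm_ring_1 \<Rightarrow> 'a::ab_group_add \<Rightarrow> 'a) \<Rightarrow> 'k fps \<Rightarrow> 'a fps \<Rightarrow> 'a fps" where
  "fps_scale scale c x = Abs_fps (\<lambda>n. \<Sum>i\<le>n. scale (fps_nth c i) (fps_nth x (n - i)))"

lemma module_fps_scale: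
  assumes "module scale"
  shows "module (fps_scale scale)"
proof -
  interpret module scale by fact
  have one: "(\<Sum>i\<le>n. scale (if i = 0 then 1 else 0) (fps_nth x (n - i))) = fps_nth x n" for n x
  proof -
    have "(\<Sum>i\<le>n. scale (if i = 0 then 1 else 0) (fps_nth x (n - i))) =
          (\<Sum>i\<le>n. if i = 0 then fps_nth x n else 0)"
      by (rule sum.cong) auto
    then show ?thesis by simp
  qed
  have assoc: "(\<Sum>i\<le>n. \<Sum>j\<le>n - i. scale (fps_nth a i * fps_nth b j) (fps_nth x (n - (i + j)))) =
      (\<Sum>k\<le>n. \<Sum>i\<le>k. scale (fps_nth a i * fps_nth b (k - i)) (fps_nth x (n - k)))" for n a b x
  proof -
    have *: "(SIGMA i:{..n}. {..n - i}) = {(i, j). i + j \<le> n}" by auto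
    show ?thesis
      using sum.triangle_reindex_eq
        [of "\<lambda>i j. scale (fps_nth a i * fps_nth b j) (fps_nth x (n - i - j))" n]
      by (simp add: sum.Sigma *)
  qed
  show ?thesis
  proof
    show "fps_scale scale a (fps_scale scale b x) = fps_scale scale (a * b) x" for a b x
      using assoc by (simp add: fps_scale_def fps_eq_iff fps_mult_nth scale_sum_right
          scale_sum_left atLeast0AtMost)
  qed (simp_all add: fps_scale_def fps_eq_iff sum.distrib algebra_simps one)
qed

text \<open>
  A power series of (bi)linear maps is given by its sequence of coefficients; the next two
  functions are its \<open>K[[t]]\<close>-linear extensions
  \<open>\<Sum>\<^sub>j x\<^sub>j t^j \<mapsto> \<Sum>\<^sub>i\<^sub>,\<^sub>j \<phi>\<^sub>i(x\<^sub>j) t^(i+j)\<close> and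
  \<open>(\<Sum>\<^sub>j x\<^sub>j t^j, \<Sum>\<^sub>k y\<^sub>k t^k) \<mapsto> \<Sum>\<^sub>i\<^sub>,\<^sub>j\<^sub>,\<^sub>k m\<^sub>i(x\<^sub>j, y\<^sub>k) t^(i+j+k)\<close> to \<open>A[[t]]\<close>.
\<close>

definition fps_ext1 :: "(nat \<Rightarrow> 'a::ab_group_add \<Rightarrow> 'a) \<Rightarrow> 'a fps \<Rightarrow> 'a fps" where
  "fps_ext1 \<phi> x = Abs_fps (\<lambda>n. \<Sum>i\<le>n. \<phi> i (fps_nth x (n - i)))"

definition fps_ext2 ::
    "(nat \<Rightarrow> 'a::ab_group_add \<Rightarrow> 'a \<Rightarrow> 'a) \<Rightarrow> 'a fps \<Rightarrow> 'a fps \<Rightarrow> 'a fps" where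
  "fps_ext2 m x y =
     Abs_fps (\<lambda>n. \<Sum>i\<le>n. \<Sum>j\<le>n - i. m i (fps_nth x j) (fps_nth y (n - i - j)))"

definition formal_deformation ::
    "('k::field_char_0 \<Rightarrow> 'a::ab_group_add \<Rightarrow> 'a) \<Rightarrow> ('a \<Rightarrow> 'a \<Rightarrow> 'a) \<Rightarrow> 'k \<Rightarrow>
     ('a \<Rightarrow> 'a) \<Rightarrow> ('a \<Rightarrow> 'a) \<Rightarrow>
     (nat \<Rightarrow> 'a \<Rightarrow> 'a \<Rightarrow> 'a) \<Rightarrow> (nat \<Rightarrow> 'a \<Rightarrow> 'a) \<Rightarrow> (nat \<Rightarrow> 'a \<Rightarrow> 'a) \<Rightarrow> bool" where
  "formal_deformation scale \<mu> lam R d \<mu>t Rt dt \<longleftrightarrow>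
     (\<forall>i. alternating_bilinear scale (\<mu>t i)) \<and>
     (\<forall>i. module_hom scale scale (Rt i)) \<and>
     (\<forall>i. module_hom scale scale (dt i)) \<and>
     \<mu>t 0 = \<mu> \<and> Rt 0 = R \<and> dt 0 = d \<and>
     modified_RB_LieDer_pair (fps_scale scale)
       (fps_ext2 \<mu>t) (fps_const lam) (fps_ext1 Rt) (fps_ext1 dt)"

definition equivalent_deformations ::
    "('k::field_char_0 \<Rightarrow> 'a::ab_group_add \<Rightarrow> 'a) \<Rightarrow>
     (nat \<Rightarrow> 'a \<Rightarrow> 'a \<Rightarrow> 'a) \<Rightarrow> (nat \<Rightarrow> 'a \<Rightarrow> 'a) \<Rightarrow> (nat \<Rightarrow> 'a \<Rightarrow> 'a) \<Rightarrow>
     (nat \<Rightarrow> 'a \<Rightarrow> 'a \<Rightarrow> 'a) \<Rightarrow> (nat \<Rightarrow> 'a \<Rightarrow> 'a) \<Rightarrow> (nat \<Rightarrow> 'a \<Rightarrow> 'a) \<Rightarrow> bool" where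
  "equivalent_deformations scale \<mu>t Rt dt \<mu>t' Rt' dt' \<longleftrightarrow>
     (\<exists>\<psi>t. (\<forall>i. module_hom scale scale (\<psi>t i)) \<and> \<psi>t 0 = id \<and>
       (\<forall>x y. fps_ext1 \<psi>t (fps_ext2 \<mu>t' x y) = fps_ext2 \<mu>t (fps_ext1 \<psi>t x) (fps_ext1 \<psi>t y)) \<and>
       fps_ext1 \<psi>t \<circ> fps_ext1 Rt' = fps_ext1 Rt \<circ> fps_ext1 \<psi>t \<and>
       fps_ext1 \<psi>t \<circ> fps_ext1 dt' = fps_ext1 dt \<circ> fps_ext1 \<psi>t)"

text \<open>The triple \<open>(\<mu>\<^sub>1, R\<^sub>1, d\<^sub>1)\<close>, regarded as a 2-cochain.\<close>

definition infinitesimal ::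
    "(nat \<Rightarrow> 'a \<Rightarrow> 'a \<Rightarrow> 'a) \<Rightarrow> (nat \<Rightarrow> 'a \<Rightarrow> 'a) \<Rightarrow> (nat \<Rightarrow> 'a \<Rightarrow> 'a) \<Rightarrow>
     'a::ab_group_add cochain2" where
  "infinitesimal \<mu>t Rt dt = ((\<mu>t 1, Rt 1), (dt 1, 0))"

end

theory Submission
  imports Defs
begin

text \<open>
  The deformation axioms and the equivalence conditions are identities between power series in
  \<open>t\<close>, and everything follows by comparing coefficients of \<open>t\<close> on constant arguments: modulo
  \<open>t\<^sup>2\<close> the structure \<open>\<mu> + \<mu>\<^sub>1 t\<close>, \<open>R + R\<^sub>1 t\<close>, \<open>d + d\<^sub>1 t\<close> obeys a product rule: the coefficient
  of \<open>t\<close> in a composite is the sum of the terms in which exactly one factor carries the index 1.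

  Applied to the axioms of \<open>(\<mu>\<^sub>t, R\<^sub>t, d\<^sub>t)\<close> this linearises them at \<open>(\<mu>, R, d)\<close>: the Jacobi
  identity, the modified Rota-Baxter identity, the derivation rule and \<open>Rd = dR\<close> become the four
  components of the cocycle condition (lemma \<open>infinitesimal_in_Z2\<close>). Applied to an equivalence
  \<open>\<psi>\<^sub>t = id + \<psi>\<^sub>1 t + ...\<close> it gives, for instance,
  \<open>\<psi>\<^sub>1[a,b] + \<mu>\<^sub>1'(a,b) = \<mu>\<^sub>1(a,b) + [\<psi>\<^sub>1 a,b] + [a,\<psi>\<^sub>1 b]\<close>,
  that is, \<open>\<mu>\<^sub>1' - \<mu>\<^sub>1 = \<delta>\<psi>\<^sub>1\<close>. The conditions on \<open>R\<close> and \<open>d\<close> complete this to the statement that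
  the infinitesimals differ by the coboundary of \<open>\<psi>\<^sub>1\<close> (lemma \<open>infinitesimal_diff_eq_D1\<close>).
\<close>

lemma fps_ext1_nth_0: "fps_nth (fps_ext1 \<phi> x) 0 = \<phi> 0 (fps_nth x 0)"
  by (simp add: fps_ext1_def)

lemma fps_ext1_nth_1:
  "fps_nth (fps_ext1 \<phi> x) 1 = \<phi> 0 (fps_nth x 1) + \<phi> 1 (fps_nth x 0)"
  by (simp add: fps_ext1_def)

lemma fps_ext2_nth_0: "fps_nth (fps_ext2 m x y) 0 = m 0 (fps_nth x 0) (fps_nth y 0)"
  by (simp add: fps_ext2_def)

lemma fps_ext2_nth_1:
  "fps_nth (fps_ext2 m x y) 1 =
     m 0 (fps_nth x 0) (fps_nth y 1) + m 0 (fps_nth x 1) (fps_nth y 0)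
     + m 1 (fps_nth x 0) (fps_nth y 0)"
  by (simp add: fps_ext2_def)

lemma fps_scale_fps_const_nth_1:
  assumes "module scale"
  shows "fps_nth (fps_scale scale (fps_const c) x) 1 = scale c (fps_nth x 1)"
proof -
  interpret module scale by fact
  show ?thesis by (simp add: fps_scale_def)
qed

lemmas low_coefficients =
  fps_ext1_nth_0 fps_ext1_nth_1 fps_ext2_nth_0 fps_ext2_nth_1 fps_scale_fps_const_nth_1

lemma alternating_bilinear_skew:
  assumes "alternating_bilinear scale f"
  shows "f a b = - f b a"
proof -
  have l: "module_hom scale scale (\<lambda>b. f a b)" and r: "module_hom scale scale (\<lambda>a. f a b)"
    and alt: "f a a = 0" for a b
    using assms by (auto simp: alternating_bilinear_def)
  have "f a b + f b a = 0"
    using alt[of "a + b"] alt[of a] alt[of b]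
    by (simp add: module_hom.add[OF l] module_hom.add[OF r] add.commute)
  then show ?thesis by (simp add: eq_neg_iff_add_eq_0)
qed

lemma alternating_bilinear_minus_right:
  assumes "alternating_bilinear scale f"
  shows "f a (- b) = - f a b"
  using assms unfolding alternating_bilinear_def by (blast dest: module_hom.neg)

context modified_RB_LieDer_pair
begin

lemma bracket_zero_left: "\<mu> 0 b = 0" and bracket_zero_right: "\<mu> a 0 = 0"
  using bracket_alternating_bilinear unfolding alternating_bilinear_def
  by (blast dest: module_hom.zero)+

lemma R_simps: "R 0 = 0" "R (a + b) = R a + R b" "R (a - b) = R a - R b" "R (- a) = - R a"
  using R_linear by (simp_all add: module_hom.zero module_hom.add module_hom.diff module_hom.neg)

lemma d_zero: "d 0 = 0"
  using d_linear by (rule module_hom.zero)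

lemma infinitesimal_in_Z2:
  assumes alt: "\<And>i. alternating_bilinear scale (\<mu>t i)"
    and lin: "module_hom scale scale (Rt 1)" "module_hom scale scale (dt 1)"
    and zero: "\<mu>t 0 = \<mu>" "Rt 0 = R" "dt 0 = d"
    and pair: "modified_RB_LieDer_pair (fps_scale scale)
       (fps_ext2 \<mu>t) (fps_const lam) (fps_ext1 Rt) (fps_ext1 dt)"
  shows "infinitesimal \<mu>t Rt dt \<in> Z2"
proof -
  interpret t: modified_RB_LieDer_pair "fps_scale scale"
    "fps_ext2 \<mu>t" "fps_const lam" "fps_ext1 Rt" "fps_ext1 dt" by (rule pair)
  note skew = alternating_bilinear_skew[OF bracket_alternating_bilinear]
    and skew1 = alternating_bilinear_skew[OF alt]
  note coeffs = low_coefficients[unfolded One_nat_def] zero fps_nth_fps_const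
    bracket_zero_left bracket_zero_right R_simps d_zero module_axioms

  have "delta2_CE (\<mu>t 1) a b c = 0" for a b c
  proof -
    have J: "\<mu> a (\<mu>t 1 b c) + \<mu>t 1 a (\<mu> b c) + (\<mu> b (\<mu>t 1 c a) + \<mu>t 1 b (\<mu> c a))
        + (\<mu> c (\<mu>t 1 a b) + \<mu>t 1 c (\<mu> a b)) = 0"
      using arg_cong[OF t.jacobi[of "fps_const a" "fps_const b" "fps_const c"],
          of "\<lambda>x. fps_nth x 1"]
      by (simp add: coeffs)
    \<comment> \<open>The cyclic sum becomes the differential after reordering arguments by skew-symmetry.\<close>
    have "\<mu> b (\<mu>t 1 c a) = - \<mu> b (\<mu>t 1 a c)"
      using skew1[of 1 c a]
      by (simp add: alternating_bilinear_minus_right[OF bracket_alternating_bilinear])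
    moreover have "\<mu>t 1 b (\<mu> c a) = \<mu>t 1 (\<mu> a c) b"
      using skew[of c a] skew1[of 1 b "\<mu> a c"]
      by (simp add: alternating_bilinear_minus_right[OF alt])
    ultimately show ?thesis
      using J skew1[of 1 a "\<mu> b c"] skew1[of 1 c "\<mu> a b"]
      by (simp add: delta2_CE_def algebra_simps)
  qed
  moreover have "(- delta1_mRBO (Rt 1) - phi2 (\<mu>t 1)) a b = 0" for a b
  proof -
    have "\<mu> (R a) (Rt 1 b) + \<mu> (Rt 1 a) (R b) + \<mu>t 1 (R a) (R b) =
        R (\<mu> (Rt 1 a) b + \<mu>t 1 (R a) b + (\<mu> a (Rt 1 b) + \<mu>t 1 a (R b)))
        + Rt 1 (\<mu> (R a) b + \<mu> a (R b)) + lam *s \<mu>t 1 a b"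
      using arg_cong[OF t.R_modified_Rota_Baxter[of "fps_const a" "fps_const b"],
          of "\<lambda>x. fps_nth x 1"]
      by (simp add: coeffs)
    then show ?thesis
      using skew[of b "Rt 1 a"] skew[of "R b" "Rt 1 a"]
      by (simp add: delta1_mRBO_def phi2_def rho_R_def bracket_R_def R_simps algebra_simps)
  qed
  moreover have "(delta1_CE (dt 1) + Delta2 (\<mu>t 1)) a b = 0" for a b
  proof -
    have "d (\<mu>t 1 a b) + dt 1 (\<mu> a b) =
        \<mu> (dt 1 a) b + \<mu>t 1 (d a) b + (\<mu> a (dt 1 b) + \<mu>t 1 a (d b))"
      using arg_cong[OF t.d_derivation[of "fps_const a" "fps_const b"], of "\<lambda>x. fps_nth x 1"]
      by (simp add: coeffs)
    then show ?thesis
      using skew[of b "dt 1 a"] by (simp add: delta1_CE_def Delta2_def algebra_simps)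
  qed
  moreover have "(- delta0_mRBO 0 - phi1 (dt 1) + Delta1 (Rt 1)) a = 0" for a
  proof -
    have "R (dt 1 a) + Rt 1 (d a) = d (Rt 1 a) + dt 1 (R a)"
      using arg_cong[OF fun_cong[OF t.R_d_commute, of "fps_const a"], of "\<lambda>x. fps_nth x 1"]
      by (simp add: coeffs)
    then show ?thesis
      by (simp add: delta0_mRBO_def rho_R_def bracket_zero_right R_simps phi1_def Delta1_def
          algebra_simps)
  qed
  ultimately have "D2 (infinitesimal \<mu>t Rt dt) = 0"
    by (simp add: D2_def infinitesimal_def zero_prod_def fun_eq_iff)
  then show ?thesis
    using alt lin by (simp add: Z2_def C2_def infinitesimal_def)
qed

text \<open>
  The primed infinitesimal comes first because \<open>\<psi>\<^sub>t\<close> maps the primed deformation to the unprimed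
  one; this is the orientation that matches the signs of \<^const>\<open>D1\<close>.
\<close>

lemma infinitesimal_diff_eq_D1:
  assumes \<mu>: "\<mu>t 0 = \<mu>" "\<mu>t' 0 = \<mu>" and R: "Rt 0 = R" "Rt' 0 = R" and d: "dt 0 = d" "dt' 0 = d"
    and \<psi>: "\<psi>t 0 = id" "module_hom scale scale (\<psi>t 1)"
    and \<psi>_\<mu>: "\<And>x y. fps_ext1 \<psi>t (fps_ext2 \<mu>t' x y) =
      fps_ext2 \<mu>t (fps_ext1 \<psi>t x) (fps_ext1 \<psi>t y)"
    and \<psi>_R: "fps_ext1 \<psi>t \<circ> fps_ext1 Rt' = fps_ext1 Rt \<circ> fps_ext1 \<psi>t"
    and \<psi>_d: "fps_ext1 \<psi>t \<circ> fps_ext1 dt' = fps_ext1 dt \<circ> fps_ext1 \<psi>t"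
  shows "infinitesimal \<mu>t' Rt' dt' - infinitesimal \<mu>t Rt dt = D1 (\<psi>t 1)"
proof -
  note coeffs = low_coefficients[unfolded One_nat_def] \<mu> R d \<psi> fps_nth_fps_const
    bracket_zero_left bracket_zero_right R_simps d_zero
  have "\<mu>t' 1 a b - \<mu>t 1 a b = delta1_CE (\<psi>t 1) a b" for a b
  proof -
    have "\<mu>t' 1 a b + \<psi>t 1 (\<mu> a b) = \<mu> a (\<psi>t 1 b) + \<mu> (\<psi>t 1 a) b + \<mu>t 1 a b"
      using arg_cong[OF \<psi>_\<mu>[of "fps_const a" "fps_const b"], of "\<lambda>x. fps_nth x 1"]
      by (simp add: coeffs)
    then show ?thesis
      using alternating_bilinear_skew[OF bracket_alternating_bilinear, of b "\<psi>t 1 a"]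
      by (simp add: delta1_CE_def algebra_simps)
  qed
  moreover have "Rt' 1 a - Rt 1 a = - phi1 (\<psi>t 1) a" for a
  proof -
    have "Rt' 1 a + \<psi>t 1 (R a) = R (\<psi>t 1 a) + Rt 1 a"
      using arg_cong[OF fun_cong[OF \<psi>_R, of "fps_const a"], of "\<lambda>x. fps_nth x 1"]
      by (simp add: coeffs)
    then show ?thesis by (simp add: phi1_def algebra_simps)
  qed
  moreover have "dt' 1 a - dt 1 a = - Delta1 (\<psi>t 1) a" for a
  proof -
    have "dt' 1 a + \<psi>t 1 (d a) = d (\<psi>t 1 a) + dt 1 a"
      using arg_cong[OF fun_cong[OF \<psi>_d, of "fps_const a"], of "\<lambda>x. fps_nth x 1"]
      by (simp add: coeffs)
    then show ?thesis by (simp add: Delta1_def algebra_simps)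
  qed
  ultimately show ?thesis
    by (simp add: D1_def infinitesimal_def fun_eq_iff)
qed

end

theorem theorem4p5:
  fixes scale :: "'k::field_char_0 \<Rightarrow> 'a::ab_group_add \<Rightarrow> 'a"
    and lam :: 'k
    and \<mu> :: "'a \<Rightarrow> 'a \<Rightarrow> 'a" and R d :: "'a \<Rightarrow> 'a"
    and \<mu>t \<mu>t' :: "nat \<Rightarrow> 'a \<Rightarrow> 'a \<Rightarrow> 'a" and Rt Rt' dt dt' :: "nat \<Rightarrow> 'a \<Rightarrow> 'a"
  assumes "modified_RB_LieDer_pair scale \<mu> lam R d"
    and "formal_deformation scale \<mu> lam R d \<mu>t Rt dt"
    and "formal_deformation scale \<mu> lam R d \<mu>t' Rt' dt'"
    and "equivalent_deformations scale \<mu>t Rt dt \<mu>t' Rt' dt'"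
  shows "\<exists>c \<in> modified_RB_LieDer_pair.H2 scale \<mu> lam R d.
    infinitesimal \<mu>t Rt dt \<in> c \<and> infinitesimal \<mu>t' Rt' dt' \<in> c"
proof -
  interpret modified_RB_LieDer_pair scale \<mu> lam R d by fact
  let ?x = "infinitesimal \<mu>t Rt dt" and ?x' = "infinitesimal \<mu>t' Rt' dt'"
  have Z: "?x \<in> Z2" "?x' \<in> Z2"
    using assms(2,3) by (simp_all add: formal_deformation_def infinitesimal_in_Z2)
  from assms(4) obtain \<psi>t where \<psi>: "module_hom scale scale (\<psi>t 1)" "\<psi>t 0 = id"
    and eqs: "\<And>x y. fps_ext1 \<psi>t (fps_ext2 \<mu>t' x y) = fps_ext2 \<mu>t (fps_ext1 \<psi>t x) (fps_ext1 \<psi>t y)"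
      "fps_ext1 \<psi>t \<circ> fps_ext1 Rt' = fps_ext1 Rt \<circ> fps_ext1 \<psi>t"
      "fps_ext1 \<psi>t \<circ> fps_ext1 dt' = fps_ext1 dt \<circ> fps_ext1 \<psi>t"
    unfolding equivalent_deformations_def by blast
  have "?x' - ?x = D1 (\<psi>t 1)"
    using assms(2,3) \<psi> eqs
    by (intro infinitesimal_diff_eq_D1) (simp_all add: formal_deformation_def id_def)
  then have "?x' - ?x \<in> B2"
    using \<psi>(1) by (simp add: B2_def C1_def)
  then have "(?x', ?x) \<in> cohomologous"
    using Z by (simp add: cohomologous_def)
  then have "?x \<in> cohomologous `` {?x'}" "?x' \<in> cohomologous `` {?x'}"
    using equiv_class_self[OF cohomologous_equiv Z(2)] by auto
  moreover have "cohomologous `` {?x'} \<in> H2"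
    unfolding H2_def using Z(2) by (rule quotientI)
  ultimately show ?thesis by blast
qed

end
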